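(* Let $m$ be a positive integer, let $L=\{(x,t)\in\mathbb{R}^m\times\mathbb{R}: t\ge\|x\|\}$ be the Lorentz cone in $\mathbb{R}^m\times\mathbb{R}$, let $0<\lambda<1$, let $x^0\in\mathbb{R}^m$, and let $f:\mathbb{R}^m\to\mathbb{R}^m$ be a $\lambda$-contraction. Consider the Picard iteration $$x^{n+1}=f(x^n),\quad n\in\mathbb{N},$$ starting from $x^0$, the iteration in $\mathbb{R}$ $$t^{n+1}=\lambda t^n+\|x^1-x^0\|,\quad n\in\mathbb{N},$$ starting from $t^0=0$, and the set $$\Omega=\left\{(x,t)\in\mathbb{R}^m\times\mathbb{R}:\ t\ge\|x-x^0\|,\ \ t\ge\frac{\|x^1-x^0\|+\|f(x)-x\|}{1-\lambda}\right\}.$$ Then $\Omega$ is nonempty, and the sequence $\big((x^n,t^n)\big)_{n\in\mathbb{N}}$ is $L$-increasing, i.e. $(x^n,t^n)\le_L(x^{n+1},t^{n+1})$ for all $n\in\mathbb{N}$, and is $L$-bounded from above by any element of $\Omega$, i.e. $(x^n,t^n)\le_L(x,t)$ for all $n\in\mathbb{N}$ and all $(x,t)\in\Omega$; hence it is convergent. Its limit $(x^*,t^* )$ is a lower $L$-bound of $\Omega$, i.e. $(x^*,t^* )\le_L(x,t)$ for all $(x,t)\in\Omega$, and $x^*$ is the unique fixed point of $f$.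
   Context: $\|\cdot\|$ denotes the Euclidean norm. $\mathbb{N}=\{0,1,2,\dots\}$. Superscripts on $x^n$ and $t^n$ are sequence indices, not powers. For $0<\lambda<1$, a map $f:\mathbb{R}^m\to\mathbb{R}^m$ is a $\lambda$-contraction if $\|f(x)-f(y)\|\le\lambda\|x-y\|$ for all $x,y\in\mathbb{R}^m$. The order $\le_L$ on $\mathbb{R}^m\times\mathbb{R}$ induced by the cone $L$ is defined by $u\le_L v\iff v-u\in L$; thus $(x,t)\le_L(y,s)$ if and only if $s-t\ge\|y-x\|$. A sequence is $L$-increasing (respectively $L$-bounded from above) if it is increasing (respectively bounded from above) with respect to $\le_L$, and a lower $L$-bound of a set is a lower bound of the set with respect to $\le_L$. Convergence is in the usual topology of $\mathbb{R}^m\times\mathbb{R}$. *)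

theory Defs
  imports "HOL-Analysis.Analysis"
begin

definition lorentz_cone :: "((real ^ 'm) \<times> real) set"
  where "lorentz_cone = {(x, t). t \<ge> norm x}"

definition lorentz_le :: "(real ^ 'm) \<times> real \<Rightarrow> (real ^ 'm) \<times> real \<Rightarrow> bool"
    (infix "\<le>\<^sub>L" 50)
  where "u \<le>\<^sub>L v \<longleftrightarrow> v - u \<in> lorentz_cone"

definition is_contraction :: "real \<Rightarrow> (real ^ 'm \<Rightarrow> real ^ 'm) \<Rightarrow> bool"
  where "is_contraction l f \<longleftrightarrow>
    0 < l \<and> l < 1 \<and> (\<forall>x y. norm (f x - f y) \<le> l * norm (x - y))"

end

theory Submission
  imports Defs
begin

text \<open>
  In the Lorentz order the scalar component dominates the vector component: an increasing sequence
  satisfies \<open>norm (x m - x n) \<le> \<bar>t m - t n\<bar>\<close>. An order bound makes \<open>t\<close> a bounded monotone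
  sequence, so \<open>t\<close> is Cauchy and \<open>x\<close> inherits this. For a member \<open>(y, s)\<close> of \<open>\<Omega>\<close> the bound
  \<open>norm (y - x n) \<le> s - t n\<close> propagates along the iteration because the second condition defining \<open>\<Omega>\<close>
  says \<open>norm (x 1 - x 0) + norm (f y - y) + l * s \<le> s\<close>.
\<close>

lemma lorentz_le_iff: "(x, t) \<le>\<^sub>L (y, s) \<longleftrightarrow> norm (y - x) \<le> s - t"
  by (simp add: lorentz_le_def lorentz_cone_def)

lemma lorentz_le_refl: "u \<le>\<^sub>L u"
  by (cases u) (simp add: lorentz_le_iff)

lemma lorentz_le_trans:
  assumes "u \<le>\<^sub>L v" and "v \<le>\<^sub>L w"
  shows "u \<le>\<^sub>L w"
proof -
  obtain x t y s z r where "u = (x, t)" "v = (y, s)" "w = (z, r)"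
    by (metis surj_pair)
  moreover have "norm (z - x) \<le> norm (z - y) + norm (y - x)"
    using norm_triangle_ineq[of "z - y" "y - x"] by simp
  ultimately show ?thesis
    using assms by (simp add: lorentz_le_iff)
qed

text \<open>The cone is closed, so an upper bound of every term survives in the limit. Applied to
  each member of \<open>\<Omega>\<close>, this makes the limit of the iteration a lower bound of
  \<open>\<Omega>\<close>.\<close>

lemma lorentz_le_limit:
  fixes X :: "nat \<Rightarrow> (real ^ 'm) \<times> real"
  assumes "X \<longlonglongrightarrow> u" and "\<And>n. X n \<le>\<^sub>L w"
  shows "u \<le>\<^sub>L w"
proof -
  obtain x t where u: "u = (x, t)" by (cases u)
  obtain y s where w: "w = (y, s)" by (cases w)
  have "(\<lambda>n. norm (y - fst (X n))) \<longlonglongrightarrow> norm (y - x)" "(\<lambda>n. s - snd (X n)) \<longlonglongrightarrow> s - t"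
    using assms(1) by (auto intro!: tendsto_eq_intros simp: u)
  moreover have "norm (y - fst (X n)) \<le> s - snd (X n)" for n
    using assms(2)[of n] lorentz_le_iff[of "fst (X n)" "snd (X n)" y s] by (simp add: w)
  ultimately have "norm (y - x) \<le> s - t"
    by (blast intro: LIMSEQ_le)
  then show ?thesis by (simp add: u w lorentz_le_iff)
qed

lemma lorentz_increasing_bounded_convergent:
  fixes X :: "nat \<Rightarrow> (real ^ 'm) \<times> real"
  assumes inc: "\<And>n. X n \<le>\<^sub>L X (Suc n)" and bound: "\<And>n. X n \<le>\<^sub>L w"
  shows "convergent X"
proof -
  define x t where "x = fst \<circ> X" and "t = snd \<circ> X"
  have X: "X n = (x n, t n)" for n by (simp add: x_def t_def)
  have le: "norm (x n - x m) \<le> t n - t m" if "m \<le> n" for m n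
  proof -
    from that have "X m \<le>\<^sub>L X n"
      by (induction n rule: dec_induct) (auto intro: lorentz_le_refl lorentz_le_trans inc)
    then show ?thesis by (simp add: X lorentz_le_iff)
  qed
  have mono: "incseq t"
  proof (rule monoI)
    fix m n :: nat
    assume "m \<le> n"
    with le[of m n] norm_ge_zero[of "x n - x m"] show "t m \<le> t n" by linarith
  qed
  have "t n \<le> snd w" for n
  proof -
    have "norm (fst w - x n) \<le> snd w - t n"
      using bound[of n] lorentz_le_iff[of "x n" "t n" "fst w" "snd w"] by (simp add: X)
    then show ?thesis
      using norm_ge_zero[of "fst w - x n"] by linarith
  qed
  then obtain ts where ts: "t \<longlonglongrightarrow> ts"
    using mono incseq_convergent by blast
  \<comment> \<open>Symmetric in \<open>m\<close> and \<open>n\<close>, so any Cauchy threshold for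
    \<open>t\<close> also serves \<open>x\<close>.\<close>
  have dist_le: "dist (x m) (x n) \<le> dist (t m) (t n)" for m n
    using le[of m n] le[of n m] by (cases "m \<le> n") (auto simp: dist_norm norm_minus_commute)
  have "Cauchy t"
    using ts by (rule LIMSEQ_imp_Cauchy)
  then have "Cauchy x"
    unfolding Cauchy_def by (meson dist_le le_less_trans)
  then obtain xs where "x \<longlonglongrightarrow> xs"
    using Cauchy_convergent convergent_def by blast
  with ts have "(\<lambda>n. (x n, t n)) \<longlonglongrightarrow> (xs, ts)"
    by (intro tendsto_Pair)
  then show ?thesis
    unfolding X[symmetric] by (auto simp: convergent_def)
qed

theorem theorem1:
  fixes f :: "real ^ 'm \<Rightarrow> real ^ 'm"
    and l :: real
    and x0 :: "real ^ 'm"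
    and x :: "nat \<Rightarrow> real ^ 'm"
    and t :: "nat \<Rightarrow> real"
    and \<Omega> :: "((real ^ 'm) \<times> real) set"
  assumes "0 < l" and "l < 1"
    and "is_contraction l f"
    and "x 0 = x0"
    and "\<And>n. x (Suc n) = f (x n)"
    and "t 0 = 0"
    and "\<And>n. t (Suc n) = l * t n + norm (x 1 - x0)"
    and "\<Omega> = {(y, s). s \<ge> norm (y - x0) \<and>
                   s \<ge> (norm (x 1 - x0) + norm (f y - y)) / (1 - l)}"
  shows "\<Omega> \<noteq> {} \<and>
    (\<forall>n. (x n, t n) \<le>\<^sub>L (x (Suc n), t (Suc n))) \<and>
    (\<forall>n. \<forall>w\<in>\<Omega>. (x n, t n) \<le>\<^sub>L w) \<and>
    convergent (\<lambda>n. (x n, t n)) \<and>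
    (\<exists>xs ts. (\<lambda>n. (x n, t n)) \<longlonglongrightarrow> (xs, ts) \<and>
      (\<forall>w\<in>\<Omega>. (xs, ts) \<le>\<^sub>L w) \<and>
      f xs = xs \<and> (\<forall>y. f y = y \<longrightarrow> y = xs))"
proof -
  define d where "d = norm (x 1 - x0)"
  have contr: "norm (f a - f b) \<le> l * norm (a - b)" for a b
    using assms(3) by (auto simp: is_contraction_def)
  \<comment> \<open>At \<open>y = x0\<close> the first condition is just \<open>s \<ge> 0\<close>,
    and \<open>s\<close> is chosen to meet the second with equality.\<close>
  have "(x0, (d + norm (f x0 - x0)) / (1 - l)) \<in> \<Omega>"
    using assms(2) by (simp add: assms(8) d_def)
  then have nonempty: "\<Omega> \<noteq> {}" by blast
  \<comment> \<open>The steps of \<open>t\<close> shrink by exactly the factor \<open>l\<close>,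
    those of \<open>x\<close> by at least that much; the first steps have equal length
    \<open>norm (x 1 - x0)\<close>.\<close>
  have inc: "(x n, t n) \<le>\<^sub>L (x (Suc n), t (Suc n))" for n
  proof (induction n)
    case 0
    then show ?case
      by (simp add: lorentz_le_iff assms(4,6,7))
  next
    case (Suc n)
    have "norm (x (Suc (Suc n)) - x (Suc n)) \<le> l * norm (x (Suc n) - x n)"
      by (metis assms(5) contr)
    also have "\<dots> \<le> l * (t (Suc n) - t n)"
      using Suc assms(1) by (simp add: lorentz_le_iff)
    \<comment> \<open>Subtracting consecutive recurrences cancels the constant
      \<open>norm (x 1 - x0)\<close>.\<close>
    also have "\<dots> = t (Suc (Suc n)) - t (Suc n)"
      using assms(7)[of n] assms(7)[of "Suc n"] by (simp add: right_diff_distrib)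
    finally show ?case by (simp add: lorentz_le_iff)
  qed
  have bound: "(x n, t n) \<le>\<^sub>L w" if "w \<in> \<Omega>" for n w
  proof -
    obtain y s where w: "w = (y, s)" by (cases w)
    have y0: "norm (y - x0) \<le> s" and ys: "d + norm (f y - y) \<le> (1 - l) * s"
      using that assms(2) by (auto simp: w assms(8) d_def pos_divide_le_eq mult.commute)
    have "norm (y - x n) \<le> s - t n"
    proof (induction n)
      case 0
      then show ?case using y0 by (simp add: assms(4,6))
    next
      case (Suc n)
      have "norm (y - x (Suc n)) \<le> norm (y - f y) + norm (f y - f (x n))"
        using norm_triangle_ineq[of "y - f y" "f y - f (x n)"] by (simp add: assms(5))
      also have "\<dots> \<le> norm (f y - y) + l * (s - t n)"
        using contr[of y "x n"] mult_left_mono[OF Suc, of l] assms(1) norm_minus_commute[of y "f y"]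
        by linarith
      \<comment> \<open>By \<open>ys\<close>, \<open>norm (f y - y) + l * s \<le> s - d\<close>;
        subtracting \<open>l * t n\<close> turns the right side into
        \<open>s - t (Suc n)\<close>.\<close>
      also have "\<dots> \<le> s - t (Suc n)"
        using ys assms(7)[of n] by (simp add: algebra_simps d_def)
      finally show ?case .
    qed
    then show ?thesis by (simp add: w lorentz_le_iff)
  qed
  \<comment> \<open>A single upper bound suffices, and nonemptiness of \<open>\<Omega>\<close>
    supplies it.\<close>
  have conv: "convergent (\<lambda>n. (x n, t n))"
    using nonempty bound by (blast intro: lorentz_increasing_bounded_convergent inc)
  then obtain xs ts where lim: "(\<lambda>n. (x n, t n)) \<longlonglongrightarrow> (xs, ts)"
    by (auto simp: convergent_def)
  have lower: "\<forall>w\<in>\<Omega>. (xs, ts) \<le>\<^sub>L w"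
    using lorentz_le_limit[OF lim] bound by blast
  have x_lim: "x \<longlonglongrightarrow> xs"
    using tendsto_fst[OF lim] by simp
  have "l-lipschitz_on UNIV f"
    using assms(1) contr by (auto intro!: lipschitz_onI simp: dist_norm)
  then have "isCont f xs"
    using lipschitz_on_continuous_on continuous_on_eq_continuous_at open_UNIV by blast
  \<comment> \<open>By continuity the shifted sequence tends to \<open>f xs\<close>, but as a shift
    of \<open>x\<close> it also tends to \<open>xs\<close>.\<close>
  then have "(\<lambda>n. x (Suc n)) \<longlonglongrightarrow> f xs"
    unfolding assms(5) using x_lim by (rule isCont_tendsto_compose)
  then have fixed: "f xs = xs"
    using LIMSEQ_Suc[OF x_lim] LIMSEQ_unique by blast
  have unique: "y = xs" if "f y = y" for y
  proof (rule ccontr)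
    assume "y \<noteq> xs"
    then have "l * norm (y - xs) < norm (y - xs)"
      using assms(2) by simp
    then show False
      using contr[of y xs] that fixed by simp
  qed
  show ?thesis
    using nonempty inc bound conv lim lower fixed unique by blast
qed

end
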